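(* Let $\mathscr H=(V,E)$ be a hypergraph such that $\mathrm{Bip}\,\mathscr H$ is connected. The integer lattice points in the polymatroid $P_{\mathscr H}$ of $\mathscr H$ are exactly the functions $f\colon E\to\mathbf N$ such that $\mathrm{Bip}\,\mathscr H$ has a cycle-free subgraph with valence $f(e)+1$ at each $e\in E$. The hypertree polytope $Q_{\mathscr H}$ coincides with the base polytope of $P_{\mathscr H}$.
   Context: A hypergraph is a pair $\mathscr H=(V,E)$ with $V$ a finite set and $E$ a finite multiset of non-empty subsets of $V$ (hyperedges). $\mathrm{Bip}\,\mathscr H$ is the bipartite graph with color classes $V$ and $E$, with $v$ joined to $e$ iff $v\in e$. $\mathbf N=\{0,1,2,\ldots\}$. For a non-empty $E'\subset E$, $\bigcup E'\subset V$ is the union of the hyperedges in $E'$, and $c(E')$ is the number of connected components of the bipartite graph $\mathrm{Bip}\,\mathscr H|_{E'}$ with color classes $E'$ and $\bigcup E'$ and edges inherited from $\mathrm{Bip}\,\mathscr H$. Put $\mu(E')=|\bigcup E'|-c(E')$ for non-empty $E'\subset E$ and $\mu(\varnothing)=0$; this is a non-decreasing submodular set function on $E$. The polymatroid of $\mathscr H$ is $$P_{\mathscr H}=P_\mu=\Bigl\{x\in\mathbf R^E \Bigm| x\ge 0,\ \sum_{e\in E'}x(e)\le\mu(E')\text{ for all }E'\subset E\Bigr\}.$$ Its base polytope is $$B_\mu=\Bigl\{x\in\mathbf R^E \Bigm| \sum_{e\in E'}x(e)\le\mu(E')\text{ for all }E'\subset E,\ \sum_{e\in E}x(e)=\mu(E)\Bigr\}.$$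 The hypertree polytope $Q_{\mathscr H}\subset\mathbf R^E$ is the set of $f\in\mathbf R^E$ with $f(e)\ge0$ for all $e\in E$, $\sum_{e\in E'}f(e)\le|\bigcup E'|-c(E')$ for all non-empty $E'\subset E$, and $\sum_{e\in E}f(e)=|V|-1$. *)

theory Defs
  imports Complex_Main "HOL-Library.FuncSet"
begin

section \<open>Finite simple graphs\<close>

record 'a graph =
  gverts :: "'a set"
  gedges :: "'a set set"

definition wf_graph :: "'a graph \<Rightarrow> bool" where
  "wf_graph G \<longleftrightarrow> finite (gverts G) \<and> (\<forall>a \<in> gedges G. a \<subseteq> gverts G \<and> card a = 2)"

definition is_subgraph :: "'a graph \<Rightarrow> 'a graph \<Rightarrow> bool" where
  "is_subgraph T G \<longleftrightarrow> wf_graph T \<and> gverts T \<subseteq> gverts G \<and> gedges T \<subseteq> gedges G"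

definition induced_subgraph :: "'a graph \<Rightarrow> 'a set \<Rightarrow> 'a graph" where
  "induced_subgraph G W = \<lparr>gverts = W, gedges = {a \<in> gedges G. a \<subseteq> W}\<rparr>"

definition valence :: "'a graph \<Rightarrow> 'a \<Rightarrow> nat" where
  "valence G u = card {a \<in> gedges G. u \<in> a}"

definition reach_rel :: "'a graph \<Rightarrow> ('a \<times> 'a) set" where
  "reach_rel G = {(u, w) \<in> gverts G \<times> gverts G. (u, w) \<in> {(s, t). {s, t} \<in> gedges G}\<^sup>*}"

definition graph_components :: "'a graph \<Rightarrow> 'a set set" where
  "graph_components G = gverts G // reach_rel G"

text \<open>The graph without vertices is not connected.\<close>

definition connected_graph :: "'a graph \<Rightarrow> bool" where
  "connected_graph G \<longleftrightarrow>
     gverts G \<noteq> {} \<and> (\<forall>u \<in> gverts G. \<forall>w \<in> gverts G. (u, w) \<in> reach_rel G)"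

text \<open>A cycle is given by the list of its vertices in cyclic order.\<close>

definition is_cycle :: "'a graph \<Rightarrow> 'a list \<Rightarrow> bool" where
  "is_cycle G p \<longleftrightarrow> 3 \<le> length p \<and> distinct p \<and>
     (\<forall>i < length p. {p ! i, p ! (Suc i mod length p)} \<in> gedges G)"

definition cycle_free :: "'a graph \<Rightarrow> bool" where
  "cycle_free G \<longleftrightarrow> (\<nexists>p. is_cycle G p)"


section \<open>Hypergraphs\<close>

text \<open>The multiset of hyperedges is an indexed family: \<open>hedges H\<close> is the set of indices (the
  individual hyperedges, counted with multiplicity), and \<open>ends H e\<close> is the subset of the vertex
  set that the hyperedge \<open>e\<close> stands for. Distinct hyperedges may have the same \<open>ends\<close>.\<close>

record ('v, 'e) hypergraph =
  hverts :: "'v set"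
  hedges :: "'e set"
  ends :: "'e \<Rightarrow> 'v set"

definition wf_hypergraph :: "('v, 'e) hypergraph \<Rightarrow> bool" where
  "wf_hypergraph H \<longleftrightarrow> finite (hverts H) \<and> finite (hedges H) \<and>
     (\<forall>e \<in> hedges H. ends H e \<noteq> {} \<and> ends H e \<subseteq> hverts H)"

definition bip :: "('v, 'e) hypergraph \<Rightarrow> ('v + 'e) graph" where
  "bip H = \<lparr>gverts = Inl ` hverts H \<union> Inr ` hedges H,
            gedges = {{Inl v, Inr e} | v e. v \<in> hverts H \<and> e \<in> hedges H \<and> v \<in> ends H e}\<rparr>"

definition hunion :: "('v, 'e) hypergraph \<Rightarrow> 'e set \<Rightarrow> 'v set" where
  "hunion H E' = (\<Union>e \<in> E'. ends H e)"

definition bip_restrict :: "('v, 'e) hypergraph \<Rightarrow> 'e set \<Rightarrow> ('v + 'e) graph" where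
  "bip_restrict H E' = induced_subgraph (bip H) (Inl ` hunion H E' \<union> Inr ` E')"

definition num_comps :: "('v, 'e) hypergraph \<Rightarrow> 'e set \<Rightarrow> nat" where
  "num_comps H E' = card (graph_components (bip_restrict H E'))"

definition mu :: "('v, 'e) hypergraph \<Rightarrow> 'e set \<Rightarrow> real" where
  "mu H E' = (if E' = {} then 0 else real (card (hunion H E')) - real (num_comps H E'))"


section \<open>Polytopes\<close>

text \<open>The space of real vectors indexed by a finite set \<open>S\<close> is \<open>S \<rightarrow>\<^sub>E UNIV\<close>, the
  functions that are \<open>undefined\<close> outside \<open>S\<close>.\<close>

definition polymatroid :: "'e set \<Rightarrow> ('e set \<Rightarrow> real) \<Rightarrow> ('e \<Rightarrow> real) set" where
  "polymatroid S m = {x \<in> S \<rightarrow>\<^sub>E UNIV.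
     (\<forall>e \<in> S. 0 \<le> x e) \<and> (\<forall>E' \<subseteq> S. (\<Sum>e \<in> E'. x e) \<le> m E')}"

definition base_polytope :: "'e set \<Rightarrow> ('e set \<Rightarrow> real) \<Rightarrow> ('e \<Rightarrow> real) set" where
  "base_polytope S m = {x \<in> S \<rightarrow>\<^sub>E UNIV.
     (\<forall>E' \<subseteq> S. (\<Sum>e \<in> E'. x e) \<le> m E') \<and> (\<Sum>e \<in> S. x e) = m S}"

definition hypergraph_polymatroid :: "('v, 'e) hypergraph \<Rightarrow> ('e \<Rightarrow> real) set" where
  "hypergraph_polymatroid H = polymatroid (hedges H) (mu H)"

definition hypertree_polytope :: "('v, 'e) hypergraph \<Rightarrow> ('e \<Rightarrow> real) set" where
  "hypertree_polytope H = {f \<in> hedges H \<rightarrow>\<^sub>E UNIV.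
     (\<forall>e \<in> hedges H. 0 \<le> f e) \<and>
     (\<forall>E' \<subseteq> hedges H. E' \<noteq> {} \<longrightarrow>
        (\<Sum>e \<in> E'. f e) \<le> real (card (hunion H E')) - real (num_comps H E')) \<and>
     (\<Sum>e \<in> hedges H. f e) = real (card (hverts H)) - 1}"

end

theory Submission
  imports Defs "HOL-Library.Transitive_Closure_Table"
begin

text \<open>A forest inside a graph has at most as many edges as there are vertices minus components; applied
  to the edges at \<open>E'\<close>, of which there are \<open>f(E') + |E'|\<close>, this puts \<open>f\<close> into the polymatroid.
  Conversely, a lattice point of the polymatroid satisfies \<open>f(E') < |\<Union>E'|\<close> for all non-empty \<open>E'\<close>.
  As in Lovasz's proof of his forest representation theorem, the hyperedges can then be shrunk, keeping these
  inequalities, until \<open>e\<close> has exactly \<open>f(e) + 1\<close> points. The resulting incidence graph has no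
  cycle: the \<open>k\<close> hyperedges of a cycle would share \<open>k\<close> points, two of them in each hyperedge, and so
  cover at most \<open>k + (f(E') - k)\<close> points altogether. For the base polytope, non-negativity follows
  from the monotonicity of \<open>\<mu>\<close>.\<close>

section \<open>Components of finite graphs\<close>

lemma sym_gedges: "sym {(s, t). {s, t} \<in> gedges G}"
  by (auto simp: sym_def insert_commute)

lemma equiv_reach_rel: "equiv (gverts G) (reach_rel G)"
proof (rule equivI)
  show "reach_rel G \<subseteq> gverts G \<times> gverts G"
    by (auto simp: reach_rel_def)
  show "refl_on (gverts G) (reach_rel G)"
    by (auto simp: refl_on_def reach_rel_def)
  show "sym (reach_rel G)"
    using sym_rtrancl[OF sym_gedges, of G] by (auto simp: sym_def reach_rel_def)
  show "trans (reach_rel G)"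
    by (auto simp: trans_def reach_rel_def)
qed

lemma reach_rel_edge:
  assumes "{s, t} \<in> gedges G" "s \<in> gverts G" "t \<in> gverts G"
  shows "(s, t) \<in> reach_rel G"
  using assms by (auto simp: reach_rel_def)

lemma reach_rel_mono:
  assumes "gverts G \<subseteq> gverts G'" "gedges G \<subseteq> gedges G'"
  shows "reach_rel G \<subseteq> reach_rel G'"
proof -
  have "{(s, t). {s, t} \<in> gedges G}\<^sup>* \<subseteq> {(s, t). {s, t} \<in> gedges G'}\<^sup>*"
    using assms(2) by (intro rtrancl_mono) auto
  then show ?thesis
    using assms(1) by (auto simp: reach_rel_def)
qed

lemma graph_components_eq: "graph_components G = (\<lambda>u. reach_rel G `` {u}) ` gverts G"
  by (auto simp: graph_components_def quotient_def)

lemma finite_graph_components: "finite (gverts G) \<Longrightarrow> finite (graph_components G)"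
  by (simp add: graph_components_eq)

text \<open>A component of the smaller graph stays inside one class of the larger one. So taking
  images under \<open>reach_rel G'\<close> is a well-defined map from components of \<open>G\<close>
  to classes of \<open>G'\<close>.\<close>

lemma reach_rel_class_absorb:
  assumes "reach_rel G \<subseteq> reach_rel G'" "u \<in> gverts G"
  shows "reach_rel G' `` (reach_rel G `` {u}) = reach_rel G' `` {u}"
proof -
  have "(u, u) \<in> reach_rel G"
    using assms(2) by (auto simp: reach_rel_def)
  moreover have "(u, y) \<in> reach_rel G'" if "(u, x) \<in> reach_rel G" "(x, y) \<in> reach_rel G'" for x y
    using that assms(1) equivE[OF equiv_reach_rel[of G']] by (meson subsetD transD)
  ultimately show ?thesis
    by blast
qed

lemma classes_of_subgraph:
  assumes "reach_rel G \<subseteq> reach_rel G'"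
  shows "(\<lambda>u. reach_rel G' `` {u}) ` gverts G = (\<lambda>C. reach_rel G' `` C) ` graph_components G"
  unfolding graph_components_eq image_image
  by (intro image_cong refl) (simp add: reach_rel_class_absorb[OF assms])

text \<open>\<open>G'\<close> may have more vertices than \<open>G\<close>; only the classes of
  \<open>G'\<close> that meet \<open>G\<close> are counted. The monotonicity of \<open>mu\<close>
  needs this generality.\<close>

lemma card_classes_of_subgraph_le:
  assumes "finite (gverts G)" "reach_rel G \<subseteq> reach_rel G'"
  shows "card ((\<lambda>u. reach_rel G' `` {u}) ` gverts G) \<le> card (graph_components G)"
  by (simp add: classes_of_subgraph[OF assms(2)] card_image_le finite_graph_components[OF assms(1)])

lemma card_components_antimono:
  assumes "finite (gverts G)" "gverts G' = gverts G" "gedges G \<subseteq> gedges G'"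
  shows "card (graph_components G') \<le> card (graph_components G)"
  using card_classes_of_subgraph_le[OF assms(1) reach_rel_mono[of G G']] assms
  by (simp add: graph_components_eq[of G'])

text \<open>Passing to the larger graph maps the old components onto the new ones and merges those
  of \<open>u\<close> and \<open>w\<close>. A surjection of finite sets that is not injective lowers
  the cardinality.\<close>

lemma card_components_insert_edge:
  assumes "finite W" "u \<in> W" "w \<in> W"
    and "(u, w) \<notin> reach_rel \<lparr>gverts = W, gedges = F\<rparr>"
  shows "card (graph_components \<lparr>gverts = W, gedges = insert {u, w} F\<rparr>)
    < card (graph_components \<lparr>gverts = W, gedges = F\<rparr>)"
proof -
  let ?G = "\<lparr>gverts = W, gedges = F\<rparr>" and ?G' = "\<lparr>gverts = W, gedges = insert {u, w} F\<rparr>"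
  let ?h = "\<lambda>C. reach_rel ?G' `` C"
  have sub: "reach_rel ?G \<subseteq> reach_rel ?G'"
    by (rule reach_rel_mono) auto
  have fin: "finite (graph_components ?G)"
    by (simp add: finite_graph_components assms)
  have img: "graph_components ?G' = ?h ` graph_components ?G"
    using classes_of_subgraph[OF sub] by (simp add: graph_components_eq[of ?G'])
  have "\<not> inj_on ?h (graph_components ?G)"
  proof
    assume inj: "inj_on ?h (graph_components ?G)"
    have "(u, w) \<in> reach_rel ?G'"
      by (rule reach_rel_edge) (auto simp: assms)
    then have "reach_rel ?G' `` {u} = reach_rel ?G' `` {w}"
      by (rule equiv_class_eq[OF equiv_reach_rel])
    then have "?h (reach_rel ?G `` {u}) = ?h (reach_rel ?G `` {w})"
      using reach_rel_class_absorb[OF sub] assms by simp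
    then have "reach_rel ?G `` {u} = reach_rel ?G `` {w}"
      using inj assms by (auto simp: inj_on_def graph_components_eq)
    then have "(u, w) \<in> reach_rel ?G"
      using eq_equiv_class[OF _ equiv_reach_rel] assms by fastforce
    then show False
      using assms by simp
  qed
  then show ?thesis
    using fin card_image_le[OF fin] eq_card_imp_inj_on[OF fin] img by (metis le_neq_implies_less)
qed

section \<open>Cycles and the number of edges of a forest\<close>

lemma cycle_of_reachable_edge:
  assumes "(u, w) \<in> reach_rel \<lparr>gverts = W, gedges = F\<rparr>" "u \<noteq> w" "{u, w} \<notin> F"
  shows "\<exists>p. is_cycle \<lparr>gverts = W, gedges = insert {u, w} F\<rparr> p"
proof -
  let ?r = "\<lambda>s t. {s, t} \<in> F"
  have "?r\<^sup>*\<^sup>* u w"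
    using assms(1) by (simp add: reach_rel_def rtranclp_rtrancl_eq)
  then obtain xs0 where "rtrancl_path ?r u xs0 w"
    by (auto simp: rtranclp_eq_rtrancl_path)
  then obtain xs where xs: "rtrancl_path ?r u xs w" "distinct (u # xs)"
    by (meson rtrancl_path_distinct)
  have ne: "xs \<noteq> []"
    using xs(1) assms(2) by (auto elim: rtrancl_path.cases)
  have last: "last xs = w"
    using rtrancl_path_last[OF xs(1) ne] .
  \<comment> \<open>A one-edge path would be the edge \<open>{u, w}\<close>, which is not in
    \<open>F\<close>. Hence the path together with the new edge has at least the three vertices that
    a cycle requires.\<close>
  have len: "length xs \<noteq> 1"
  proof
    assume "length xs = 1"
    then have "xs = [w]"
      using last by (cases xs) auto
    then show False
      using rtrancl_path_nth[OF xs(1), of 0] assms(3) by simp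
  qed
  have "is_cycle \<lparr>gverts = W, gedges = insert {u, w} F\<rparr> (u # xs)"
    unfolding is_cycle_def
  proof (intro conjI allI impI)
    show "3 \<le> length (u # xs)"
      using ne len by (cases xs; cases "tl xs") auto
    show "distinct (u # xs)"
      by (fact xs(2))
    fix i assume i: "i < length (u # xs)"
    show "{(u # xs) ! i, (u # xs) ! (Suc i mod length (u # xs))}
        \<in> gedges \<lparr>gverts = W, gedges = insert {u, w} F\<rparr>"
    proof (cases "i < length xs")
      case True
      then show ?thesis
        using rtrancl_path_nth[OF xs(1) True] by simp
    next
      case False
      then have "i = length xs"
        using i by simp
      then have "(u # xs) ! i = w"
        using last ne by (simp add: last_conv_nth nth_Cons')
      then show ?thesis
        using \<open>i = length xs\<close> by (simp add: insert_commute)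
    qed
  qed
  then show ?thesis
    by blast
qed

lemma is_cycle_mono:
  assumes "is_cycle G p" "gedges G \<subseteq> gedges G'"
  shows "is_cycle G' p"
  using assms by (auto simp: is_cycle_def)

lemma cycle_free_mono: "cycle_free G' \<Longrightarrow> gedges G \<subseteq> gedges G' \<Longrightarrow> cycle_free G"
  unfolding cycle_free_def by (blast intro: is_cycle_mono)

text \<open>Add the edges one by one, starting from isolated vertices. An edge inside a component
  would close a cycle, so each edge costs at least one component.\<close>

lemma forest_card_edges_plus_components:
  assumes "finite F" "finite W" "\<And>a. a \<in> F \<Longrightarrow> a \<subseteq> W \<and> card a = 2"
    and "cycle_free \<lparr>gverts = W, gedges = F\<rparr>"
  shows "card F + card (graph_components \<lparr>gverts = W, gedges = F\<rparr>) \<le> card W"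
  using assms(1,3,4)
proof (induction F rule: finite_induct)
  case empty
  show ?case
    by (simp add: graph_components_eq card_image_le assms(2))
next
  case (insert a F)
  obtain u w where a: "a = {u, w}" "u \<noteq> w"
    using insert.prems(1)[of a] by (auto simp: card_2_iff)
  have uw: "u \<in> W" "w \<in> W"
    using insert.prems(1)[of a] a by auto
  have "(u, w) \<notin> reach_rel \<lparr>gverts = W, gedges = F\<rparr>"
    using cycle_of_reachable_edge[of u w W F] insert.hyps insert.prems(2) a
    by (auto simp: cycle_free_def)
  from card_components_insert_edge[OF assms(2) uw this]
  have less: "card (graph_components \<lparr>gverts = W, gedges = insert a F\<rparr>)
      < card (graph_components \<lparr>gverts = W, gedges = F\<rparr>)"
    by (simp add: a)
  have "cycle_free \<lparr>gverts = W, gedges = F\<rparr>"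
    using cycle_free_mono[OF insert.prems(2), of "\<lparr>gverts = W, gedges = F\<rparr>"] by auto
  then have "card F + card (graph_components \<lparr>gverts = W, gedges = F\<rparr>) \<le> card W"
    using insert.IH insert.prems(1) by blast
  then show ?case
    using less insert.hyps by simp
qed


section \<open>Trimming a set system with the strong Hall property\<close>

text \<open>Among the sets for which the Hall inequality is tight and which contain \<open>e\<^sub>0\<close> there is a least
  one, by submodularity. If no point of \<open>A e\<^sub>0\<close> could be removed, each of them would be missed by the
  other members of this least tight set, which would then not be tight.\<close>

lemma strong_hall_remove_point:
  fixes A :: "'e \<Rightarrow> 'v set" and f :: "'e \<Rightarrow> nat"
  assumes fin: "finite E" "\<And>e. e \<in> E \<Longrightarrow> finite (A e)"
    and hall: "\<And>E'. E' \<subseteq> E \<Longrightarrow> E' \<noteq> {} \<Longrightarrow> sum f E' < card (\<Union>(A ` E'))"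
    and e0: "e0 \<in> E" "f e0 + 1 < card (A e0)"
  shows "\<exists>v \<in> A e0. \<forall>E' \<subseteq> E. E' \<noteq> {} \<longrightarrow> sum f E' < card (\<Union>((A(e0 := A e0 - {v})) ` E'))"
proof (rule ccontr)
  assume contra: "\<not> ?thesis"
  \<comment> \<open>The Hall inequality is strict, so its extreme case is one point more than
    \<open>sum f X\<close>. Asking for \<open>e0\<close> in \<open>X\<close> keeps intersections of
    tight sets non-empty.\<close>
  define tight where "tight X \<longleftrightarrow> X \<subseteq> E \<and> e0 \<in> X \<and> card (\<Union>(A ` X)) = sum f X + 1" for X
  have finA: "finite (\<Union>(A ` X))" if "X \<subseteq> E" for X
    using that fin finite_subset by blast
  have remove_cases: "v \<notin> U' \<and> v \<in> U \<and> U' = U - {v}"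
    if "U' \<noteq> U" "U - {v} \<subseteq> U'" "U' \<subseteq> U" for U U' :: "'v set" and v
    using that by auto
  \<comment> \<open>Removing \<open>v\<close> violates the inequality for some \<open>X\<close>. The
    union loses at most the point \<open>v\<close>, so it does lose \<open>v\<close>, and
    \<open>X\<close> was tight; thus \<open>e0\<close> is in \<open>X\<close> and no other member of
    \<open>X\<close> covers \<open>v\<close>.\<close>
  have ex_tight: "\<exists>X. tight X \<and> v \<notin> \<Union>(A ` (X - {e0}))" if v: "v \<in> A e0" for v
  proof -
    let ?A = "A(e0 := A e0 - {v})"
    obtain X where X: "X \<subseteq> E" "X \<noteq> {}" "card (\<Union>(?A ` X)) \<le> sum f X"
      using contra v by (auto simp: not_less)
    have hX: "sum f X < card (\<Union>(A ` X))"
      using hall X by blast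
    have "\<Union>(?A ` X) \<noteq> \<Union>(A ` X)"
      using hX X(3) by auto
    moreover have "\<Union>(A ` X) - {v} \<subseteq> \<Union>(?A ` X)"
      by auto
    moreover have "\<Union>(?A ` X) \<subseteq> \<Union>(A ` X)"
      by (auto split: if_splits)
    ultimately have v_notin: "v \<notin> \<Union>(?A ` X)" and v_in: "v \<in> \<Union>(A ` X)"
      and eq: "\<Union>(?A ` X) = \<Union>(A ` X) - {v}"
      using remove_cases by metis+
    have e0X: "e0 \<in> X"
    proof (rule ccontr)
      assume "e0 \<notin> X"
      then have "\<Union>(?A ` X) = \<Union>(A ` X)"
        by (intro arg_cong[where f = Union] image_cong) auto
      with v_in v_notin show False
        by metis
    qed
    have "card (\<Union>(A ` X)) = card (\<Union>(?A ` X)) + 1"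
      using card_Suc_Diff1[OF finA[OF X(1)] v_in] eq by simp
    then have "tight X"
      using X hX e0X by (simp add: tight_def)
    moreover have "v \<notin> \<Union>(A ` (X - {e0}))"
      using v_notin by (auto split: if_splits)
    ultimately show ?thesis
      by blast
  qed
  \<comment> \<open>By submodularity the excesses of the union over \<open>sum f\<close> for
    \<open>X \<inter> Y\<close> and \<open>X \<union> Y\<close> add up to at most 2, and each is at
    least 1.\<close>
  have tight_Int: "tight (X \<inter> Y)" if X: "tight X" and Y: "tight Y" for X Y
  proof -
    have XY: "X \<subseteq> E" "Y \<subseteq> E" "e0 \<in> X" "e0 \<in> Y"
      using X Y by (auto simp: tight_def)
    have fXY: "finite X" "finite Y"
      using XY fin finite_subset by blast+
    have "card (\<Union>(A ` X)) + card (\<Union>(A ` Y))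
        = card (\<Union>(A ` X) \<union> \<Union>(A ` Y)) + card (\<Union>(A ` X) \<inter> \<Union>(A ` Y))"
      by (rule card_Un_Int) (use finA XY in auto)
    moreover have "card (\<Union>(A ` X) \<union> \<Union>(A ` Y)) = card (\<Union>(A ` (X \<union> Y)))"
      by (simp add: image_Un)
    moreover have "card (\<Union>(A ` (X \<inter> Y))) \<le> card (\<Union>(A ` X) \<inter> \<Union>(A ` Y))"
      by (rule card_mono) (use finA XY in auto)
    moreover have "sum f (X \<union> Y) < card (\<Union>(A ` (X \<union> Y)))" "sum f (X \<inter> Y) < card (\<Union>(A ` (X \<inter> Y)))"
      using XY by (blast intro: hall)+
    moreover have "sum f (X \<union> Y) + sum f (X \<inter> Y) = sum f X + sum f Y"
      using sum.union_inter[OF fXY] .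
    moreover have "card (\<Union>(A ` X)) = sum f X + 1" "card (\<Union>(A ` Y)) = sum f Y + 1"
      using X Y by (simp_all add: tight_def)
    ultimately have "card (\<Union>(A ` (X \<inter> Y))) = sum f (X \<inter> Y) + 1"
      by linarith
    then show ?thesis
      using XY unfolding tight_def by blast
  qed
  obtain v0 where "v0 \<in> A e0"
    using e0(2) by fastforce
  then have "\<exists>X. tight X"
    using ex_tight by blast
  then obtain Z where Z: "tight Z" and Zmin: "\<And>X. tight X \<Longrightarrow> card Z \<le> card X"
    using ex_has_least_nat[of tight _ card] by blast
  have ZE: "Z \<subseteq> E" "e0 \<in> Z"
    using Z by (auto simp: tight_def)
  have fZ: "finite Z"
    using ZE fin finite_subset by blast
  have Zleast: "Z \<subseteq> X" if "tight X" for X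
    using card_subset_eq[OF fZ, of "Z \<inter> X"] card_mono[OF fZ, of "Z \<inter> X"]
      Zmin[OF tight_Int[OF Z that]] by auto
  \<comment> \<open>For each \<open>v\<close> in \<open>A e0\<close>, the least tight set
    \<open>Z\<close> lies inside the tight set found for \<open>v\<close>, whose members other than
    \<open>e0\<close> miss \<open>v\<close>.\<close>
  have disj: "A e0 \<inter> \<Union>(A ` (Z - {e0})) = {}"
    using ex_tight Zleast by blast
  have rest_sub: "Z - {e0} \<subseteq> E"
    using ZE by blast
  have "\<Union>(A ` Z) = A e0 \<union> \<Union>(A ` (Z - {e0}))"
    using ZE by auto
  then have "card (\<Union>(A ` Z)) = card (A e0) + card (\<Union>(A ` (Z - {e0})))"
    using card_Un_disjoint[OF fin(2)[OF e0(1)] finA[OF rest_sub] disj] by simp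
  \<comment> \<open>The bound is not strict because \<open>Z\<close> may be just
    \<open>{e0}\<close>. It suffices: as \<open>A e0\<close> has more than \<open>f e0 + 1\<close>
    points, the union over \<open>Z\<close> has more than \<open>sum f Z + 1\<close>.\<close>
  moreover have "sum f (Z - {e0}) \<le> card (\<Union>(A ` (Z - {e0})))"
  proof (cases "Z - {e0} = {}")
    case True
    then show ?thesis
      by (simp only: sum.empty)
  next
    case False
    then show ?thesis
      using hall[OF rest_sub] by simp
  qed
  moreover have "sum f Z = f e0 + sum f (Z - {e0})"
    using sum.remove[OF fZ ZE(2)] .
  ultimately show False
    using Z e0(2) by (simp add: tight_def)
qed

text \<open>Points are removed by induction on the total size. The process ends exactly at
  \<open>f e + 1\<close> points, since the Hall inequality for \<open>{e}\<close> forbids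
  fewer.\<close>

lemma strong_hall_trim:
  fixes A :: "'e \<Rightarrow> 'v set" and f :: "'e \<Rightarrow> nat"
  assumes "finite E" "\<And>e. e \<in> E \<Longrightarrow> finite (A e)"
    and "\<And>E'. E' \<subseteq> E \<Longrightarrow> E' \<noteq> {} \<Longrightarrow> sum f E' < card (\<Union>(A ` E'))"
  shows "\<exists>B. (\<forall>e \<in> E. B e \<subseteq> A e \<and> card (B e) = f e + 1) \<and>
    (\<forall>E' \<subseteq> E. E' \<noteq> {} \<longrightarrow> sum f E' < card (\<Union>(B ` E')))"
  using assms(2,3)
proof (induction "\<Sum>e \<in> E. card (A e)" arbitrary: A rule: less_induct)
  case less
  show ?case
  proof (cases "\<exists>e0 \<in> E. f e0 + 1 < card (A e0)")
    case False
    have "card (A e) = f e + 1" if "e \<in> E" for e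
      using False less.prems(2)[of "{e}"] that by fastforce
    then show ?thesis
      using less.prems(2) by (intro exI[of _ A]) auto
  next
    case True
    then obtain e0 where e0: "e0 \<in> E" "f e0 + 1 < card (A e0)"
      by blast
    obtain v where v: "v \<in> A e0" and
      hall: "\<forall>E' \<subseteq> E. E' \<noteq> {} \<longrightarrow> sum f E' < card (\<Union>((A(e0 := A e0 - {v})) ` E'))"
      using strong_hall_remove_point[OF assms(1) less.prems e0] by blast
    let ?A = "A(e0 := A e0 - {v})"
    have fin: "finite (?A e)" if "e \<in> E" for e
      using less.prems(1) that e0 by auto
    have "(\<Sum>e \<in> E. card (?A e)) < (\<Sum>e \<in> E. card (A e))"
    proof (rule sum_strict_mono_ex1)
      show "\<forall>e \<in> E. card (?A e) \<le> card (A e)"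
        by (simp add: card_Diff1_le)
      show "\<exists>e \<in> E. card (?A e) < card (A e)"
        using e0 v less.prems(1)[OF e0(1)] card_Diff1_less by (intro bexI[of _ e0]) auto
    qed (fact assms(1))
    from less.hyps[OF this fin] hall obtain B where
      B: "\<forall>e \<in> E. B e \<subseteq> ?A e \<and> card (B e) = f e + 1"
      "\<forall>E' \<subseteq> E. E' \<noteq> {} \<longrightarrow> sum f E' < card (\<Union>(B ` E'))"
      by blast
    have "B e \<subseteq> A e" if "e \<in> E" for e
      using bspec[OF B(1) that] by (auto split: if_splits)
    then show ?thesis
      using B by blast
  qed
qed


section \<open>Forests from trimmed set systems\<close>

lemma incidence_cycle_free:
  fixes B :: "'e \<Rightarrow> 'v set" and f :: "'e \<Rightarrow> nat"
  assumes "finite E"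
    and card_B: "\<And>e. e \<in> E \<Longrightarrow> card (B e) = f e + 1"
    and hall: "\<And>E'. E' \<subseteq> E \<Longrightarrow> E' \<noteq> {} \<Longrightarrow> sum f E' < card (\<Union>(B ` E'))"
    and edges: "gedges T = {{Inl v, Inr e} | v e. e \<in> E \<and> v \<in> B e}"
  shows "cycle_free T"
  unfolding cycle_free_def
proof
  assume "\<exists>p. is_cycle T p"
  then obtain p where len: "3 \<le> length p" and dist: "distinct p"
    and cyc: "\<And>i. i < length p \<Longrightarrow> {p ! i, p ! (Suc i mod length p)} \<in> gedges T"
    unfolding is_cycle_def by blast
  define n where "n = length p"
  define nxt where "nxt i = Suc i mod n" for i
  \<comment> \<open>Positions on the cycle are residues modulo \<open>n\<close>. Adding
    \<open>n\<close> first protects the subtraction from truncation at position 0.\<close>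
  define prv where "prv i = (i + n - 1) mod n" for i
  have n: "3 \<le> n"
    using len by (simp add: n_def)
  have nxt_less: "nxt i < n" and prv_less: "prv i < n" for i
    using n by (auto simp: nxt_def prv_def)
  have nxt_prv: "nxt (prv i) = i" if "i < n" for i
    using n that unfolding nxt_def prv_def mod_Suc_eq by simp
  have nxt_eq: "nxt i = (if Suc i = n then 0 else Suc i)" if "i < n" for i
    using that by (simp add: nxt_def)
  have prv_eq: "prv i = (if i = 0 then n - 1 else i - 1)" if "i < n" for i
  proof (cases i)
    case (Suc j)
    then have "(i + n - 1) mod n = (j + n) mod n"
      by simp
    then show ?thesis
      using that Suc by (simp add: prv_def)
  qed (use n in \<open>simp add: prv_def\<close>)
  \<comment> \<open>Here \<open>n\<close> being at least 3 matters: it gives every visited hyperedge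
    two different neighbours on the cycle.\<close>
  have nxt_neq_prv: "nxt i \<noteq> prv i" if "i < n" for i
    using n that nxt_eq[OF that] prv_eq[OF that] by (auto split: if_splits)
  have nth_eq: "p ! i = p ! j \<longleftrightarrow> i = j" if "i < n" "j < n" for i j
    using nth_eq_iff_index_eq[OF dist] that by (simp add: n_def)
  have edge: "{p ! i, p ! nxt i} \<in> gedges T" if "i < n" for i
    using cyc that by (simp add: n_def nxt_def)
  define X where "X = {e. Inr e \<in> set p}"
  define W where "W = {v. Inl v \<in> set p}"
  have succ_of_Inl: "\<exists>e. p ! nxt i = Inr e \<and> e \<in> E \<and> v \<in> B e" if "i < n" "p ! i = Inl v" for i v
    using edge[OF that(1)] that(2) by (auto simp: edges doubleton_eq_iff)
  have succ_of_Inr: "\<exists>v. p ! nxt i = Inl v \<and> e \<in> E \<and> v \<in> B e" if "i < n" "p ! i = Inr e" for i e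
    using edge[OF that(1)] that(2) by (auto simp: edges doubleton_eq_iff)
  have pred_of_Inr: "\<exists>v. p ! prv i = Inl v \<and> v \<in> B e" if "i < n" "p ! i = Inr e" for i e
    using edge[OF prv_less[of i]] nxt_prv[OF that(1)] that(2)
    by (auto simp: edges doubleton_eq_iff)
  have in_set: "p ! i \<in> set p" if "i < n" for i
    using that by (simp add: n_def)
  have XE: "X \<subseteq> E"
    using succ_of_Inr by (fastforce simp: X_def in_set_conv_nth n_def)
  have finX: "finite X"
    using XE assms(1) finite_subset by blast
  have finW: "finite W"
    unfolding W_def using finite_vimageI[of "set p" Inl] by (simp add: vimage_def)
  have finB: "finite (B e)" if "e \<in> X" for e
    using card_B[of e] that XE by (intro card_ge_0_finite) auto
  have "X \<noteq> {}"
  proof (cases "p ! 0")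
    case (Inl v)
    then obtain e where "p ! nxt 0 = Inr e"
      using succ_of_Inl[of 0 v] n by auto
    then show ?thesis
      using in_set[OF nxt_less[of 0]] by (auto simp: X_def)
  next
    case (Inr e)
    then show ?thesis
      using in_set[of 0] n by (auto simp: X_def)
  qed
  have pos: "\<exists>i < n. p ! i = x" if "x \<in> set p" for x
    using that by (auto simp: in_set_conv_nth n_def)
  text \<open>The successor map along the cycle injects the visited vertices into the visited hyperedges.\<close>
  have "card W \<le> card X"
  proof -
    have "\<forall>v \<in> W. \<exists>i < n. p ! i = Inl v"
      using pos by (auto simp: W_def)
    then obtain idx where idx: "\<And>v. v \<in> W \<Longrightarrow> idx v < n \<and> p ! idx v = Inl v"
      by metis
    then have "\<forall>v \<in> W. \<exists>e. p ! nxt (idx v) = Inr e"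
      using succ_of_Inl by blast
    then obtain g where g: "\<And>v. v \<in> W \<Longrightarrow> p ! nxt (idx v) = Inr (g v)"
      by metis
    show ?thesis
    proof (rule card_inj_on_le[OF _ _ finX])
      show "g ` W \<subseteq> X"
      proof (rule image_subsetI)
        fix v assume "v \<in> W"
        then show "g v \<in> X"
          using in_set[OF nxt_less[of "idx v"]] g[of v] by (simp add: X_def)
      qed
      show "inj_on g W"
      proof (rule inj_onI)
        fix v w assume vw: "v \<in> W" "w \<in> W" "g v = g w"
        then have "nxt (idx v) = nxt (idx w)"
          using g nth_eq[OF nxt_less nxt_less] by metis
        then have "idx v = idx w"
          using idx vw n by (auto simp: nxt_eq split: if_splits)
        then show "v = w"
          using idx vw by (metis Inl_inject)
      qed
    qed
  qed
  \<comment> \<open>Both cycle neighbours of \<open>e\<close> lie in \<open>B e\<close> and in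
    \<open>W\<close>, so at most \<open>f e - 1\<close> of the \<open>f e + 1\<close> points of
    \<open>B e\<close> lie outside \<open>W\<close>.\<close>
  moreover have two: "card (B e - W) + 1 \<le> f e" if e: "e \<in> X" for e
  proof -
    obtain i where i: "i < n" "p ! i = Inr e"
      using pos e by (auto simp: X_def)
    obtain v w where v: "p ! nxt i = Inl v" "v \<in> B e" and w: "p ! prv i = Inl w" "w \<in> B e"
      using succ_of_Inr[OF i] pred_of_Inr[OF i] by blast
    have "v \<noteq> w"
      using nth_eq[OF nxt_less prv_less] nxt_neq_prv[OF i(1)] v w by metis
    moreover have "{v, w} \<subseteq> B e \<inter> W"
      using v w in_set[OF nxt_less[of i]] in_set[OF prv_less[of i]] by (auto simp: W_def)
    ultimately have "2 \<le> card (B e \<inter> W)"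
      using card_mono[of "B e \<inter> W" "{v, w}"] finB[OF e] by auto
    moreover have "card (B e) = card (B e \<inter> W) + card (B e - W)"
      using card_Int_Diff finB[OF e] by blast
    ultimately show ?thesis
      using card_B[of e] e XE by auto
  qed
  \<comment> \<open>Count the visited points once and the remaining ones hyperedge by hyperedge. The
    total is at most \<open>card W + sum f X - card X\<close>, hence at most \<open>sum f X\<close>,
    against the Hall inequality.\<close>
  have "card (\<Union>(B ` X)) \<le> card W + (\<Sum>e \<in> X. card (B e - W))"
  proof -
    have "card (\<Union>(B ` X)) \<le> card (W \<union> (\<Union>e \<in> X. B e - W))"
      by (rule card_mono) (use finW finX finB in auto)
    also have "\<dots> \<le> card W + card (\<Union>e \<in> X. B e - W)"
      by (rule card_Un_le)
    also have "card (\<Union>e \<in> X. B e - W) \<le> (\<Sum>e \<in> X. card (B e - W))"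
      by (rule card_UN_le[OF finX])
    finally show ?thesis
      by simp
  qed
  moreover have "(\<Sum>e \<in> X. card (B e - W)) + card X \<le> sum f X"
    using sum_mono[of X "\<lambda>e. card (B e - W) + 1" f] two
    by (simp only: sum.distrib) simp
  ultimately show False
    using hall[OF XE \<open>X \<noteq> {}\<close>] by simp
qed

lemma valence_incidence:
  assumes "e \<in> E" "gedges T = {{Inl v, Inr e} | v e. e \<in> E \<and> v \<in> B e}"
  shows "valence T (Inr e) = card (B e)"
proof -
  have "{a \<in> gedges T. Inr e \<in> a} = (\<lambda>v. {Inl v, Inr e}) ` B e"
    using assms by auto
  moreover have "inj_on (\<lambda>v. {Inl v, Inr e}) (B e)"
    by (auto simp: inj_on_def doubleton_eq_iff)
  ultimately show ?thesis
    by (simp add: valence_def card_image)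
qed


section \<open>The rank function of a hypergraph\<close>

lemma gverts_bip_restrict: "gverts (bip_restrict H E') = Inl ` hunion H E' \<union> Inr ` E'"
  by (simp add: bip_restrict_def induced_subgraph_def)

lemma gedges_bip_restrict:
  assumes "wf_hypergraph H" "E' \<subseteq> hedges H"
  shows "gedges (bip_restrict H E') = {{Inl v, Inr e} | v e. e \<in> E' \<and> v \<in> ends H e}"
  using assms
  by (fastforce simp: bip_restrict_def induced_subgraph_def bip_def hunion_def wf_hypergraph_def)

lemma finite_hunion:
  assumes "wf_hypergraph H" "E' \<subseteq> hedges H"
  shows "finite (hunion H E')"
proof (rule finite_subset)
  show "hunion H E' \<subseteq> hverts H"
    using assms by (auto simp: hunion_def wf_hypergraph_def)
qed (use assms in \<open>simp add: wf_hypergraph_def\<close>)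

lemma finite_gverts_bip_restrict:
  assumes "wf_hypergraph H" "E' \<subseteq> hedges H"
  shows "finite (gverts (bip_restrict H E'))"
  using assms finite_hunion[OF assms] finite_subset
  by (auto simp: gverts_bip_restrict wf_hypergraph_def)

text \<open>For \<open>E' = {}\<close> the restricted graph has no vertices, hence no components,
  and the difference is the default value 0.\<close>

lemma mu_eq: "mu H E' = real (card (hunion H E')) - real (num_comps H E')"
  by (simp add: mu_def num_comps_def graph_components_eq gverts_bip_restrict hunion_def)

lemma num_comps_pos:
  assumes "wf_hypergraph H" "E' \<subseteq> hedges H" "E' \<noteq> {}"
  shows "0 < num_comps H E'"
  using assms finite_graph_components[OF finite_gverts_bip_restrict[OF assms(1,2)]]
  by (simp add: num_comps_def card_gt_0_iff graph_components_eq gverts_bip_restrict)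

text \<open>All points of \<open>e\<close> fall into the class of \<open>e\<close>, so at most one
  component is added. If \<open>e\<close> brings a new point, that point pays for it; otherwise
  \<open>e\<close> joins an old component and none is added.\<close>

lemma mu_insert_ge:
  assumes H: "wf_hypergraph H" and E': "insert e E' \<subseteq> hedges H"
  shows "mu H E' \<le> mu H (insert e E')"
proof -
  let ?G = "bip_restrict H E'" and ?G' = "bip_restrict H (insert e E')"
  let ?cl = "\<lambda>u. reach_rel ?G' `` {u}"
  let ?new = "ends H e - hunion H E'"
  have sub: "E' \<subseteq> hedges H" and eH: "e \<in> hedges H"
    using E' by auto
  have fin: "finite (hunion H (insert e E'))" "finite (hunion H E')"
    using finite_hunion H E' by blast+
  have hunion_insert: "hunion H (insert e E') = hunion H E' \<union> ends H e"
    by (auto simp: hunion_def)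
  have "reach_rel ?G \<subseteq> reach_rel ?G'"
    by (rule reach_rel_mono)
      (auto simp: gverts_bip_restrict hunion_def gedges_bip_restrict[OF H] sub E' eH)
  from card_classes_of_subgraph_le[OF finite_gverts_bip_restrict[OF H sub] this]
  have old: "card (?cl ` gverts ?G) \<le> num_comps H E'"
    by (simp add: num_comps_def)
  have adj: "?cl (Inl v) = ?cl (Inr e)" if "v \<in> ends H e" for v
  proof (rule equiv_class_eq[OF equiv_reach_rel], rule reach_rel_edge)
    show "{Inl v, Inr e} \<in> gedges ?G'"
      using that by (auto simp: gedges_bip_restrict[OF H E'])
  qed (use that in \<open>auto simp: gverts_bip_restrict hunion_def\<close>)
  have "gverts ?G' \<subseteq> gverts ?G \<union> Inl ` ?new \<union> {Inr e}"
    by (auto simp: gverts_bip_restrict hunion_def)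
  then have comps': "graph_components ?G' \<subseteq> insert (?cl (Inr e)) (?cl ` gverts ?G)"
    using adj by (auto simp: graph_components_eq)
  have fin_old: "finite (?cl ` gverts ?G)"
    using finite_gverts_bip_restrict[OF H sub] by simp
  have "num_comps H (insert e E') \<le> num_comps H E' + card ?new"
  proof (cases "?new = {}")
    case True
    obtain v where v: "v \<in> ends H e"
      using H eH by (auto simp: wf_hypergraph_def)
    then have "Inl v \<in> gverts ?G"
      using True by (auto simp: gverts_bip_restrict)
    then have "?cl (Inr e) \<in> ?cl ` gverts ?G"
      using adj[OF v] by (metis imageI)
    then have "graph_components ?G' \<subseteq> ?cl ` gverts ?G"
      using comps' by blast
    then show ?thesis
      using card_mono[OF fin_old, of "graph_components ?G'"] old by (simp add: num_comps_def)
  next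
    case False
    have "finite ?new"
      using fin hunion_insert by simp
    then have "1 \<le> card ?new"
      using False by (simp add: Suc_le_eq card_gt_0_iff)
    moreover have "card (graph_components ?G') \<le> card (?cl ` gverts ?G) + 1"
      using card_mono[OF _ comps'] fin_old by (simp add: card_insert_if split: if_splits)
    ultimately show ?thesis
      using old by (simp add: num_comps_def)
  qed
  moreover have "card (hunion H (insert e E')) = card (hunion H E') + card ?new"
    using card_Un_disjoint[of "hunion H E'" ?new] fin hunion_insert by simp
  ultimately show ?thesis
    by (simp add: mu_eq)
qed

lemma mu_hedges:
  assumes H: "wf_hypergraph H" and conn: "connected_graph (bip H)"
  shows "mu H (hedges H) = real (card (hverts H)) - 1"
proof (cases "hedges H = {}")
  \<comment> \<open>Here \<open>mu\<close> is 0 by convention. A connected graph without edges has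
    one vertex, so the right side is 0 too.\<close>
  case True
  have "gedges (bip H) = {}"
    using True by (auto simp: bip_def)
  then have no_edge: "u = w" if "(u, w) \<in> reach_rel (bip H)" for u w
    using that by (simp add: reach_rel_def)
  then have "v = w" if "v \<in> hverts H" "w \<in> hverts H" for v w
  proof -
    have "(Inl v, Inl w) \<in> reach_rel (bip H)"
      using conn that by (simp add: connected_graph_def bip_def)
    from no_edge[OF this] show "v = w"
      by simp
  qed
  moreover have "hverts H \<noteq> {}"
    using conn True by (auto simp: connected_graph_def bip_def)
  ultimately obtain v where "hverts H = {v}"
    by blast
  then show ?thesis
    by (simp add: mu_def True)
next
  case False
  \<comment> \<open>A walk from \<open>v\<close> to any hyperedge is non-trivial, and its first edge
    shows that \<open>v\<close> is covered.\<close>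
  have "v \<in> hunion H (hedges H)" if v: "v \<in> hverts H" for v
  proof -
    obtain e where "e \<in> hedges H"
      using False by blast
    then have "(Inl v, Inr e) \<in> reach_rel (bip H)"
      using conn v by (auto simp: connected_graph_def bip_def)
    then have "(Inl v, Inr e) \<in> {(s, t). {s, t} \<in> gedges (bip H)}\<^sup>*"
      by (simp add: reach_rel_def)
    then obtain y where "{Inl v, y} \<in> gedges (bip H)"
      by (auto elim: converse_rtranclE)
    then show ?thesis
      by (auto simp: bip_def hunion_def doubleton_eq_iff)
  qed
  then have hunion: "hunion H (hedges H) = hverts H"
    using H by (auto simp: hunion_def wf_hypergraph_def)
  then have "bip_restrict H (hedges H) = bip H"
    by (auto simp: bip_restrict_def induced_subgraph_def bip_def)
  moreover have "graph_components (bip H) = {gverts (bip H)}"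
  proof -
    have "reach_rel (bip H) `` {u} = gverts (bip H)" if "u \<in> gverts (bip H)" for u
      using conn that by (auto simp: connected_graph_def reach_rel_def)
    moreover have "gverts (bip H) \<noteq> {}"
      using conn by (simp add: connected_graph_def)
    ultimately show ?thesis
      by (auto simp: graph_components_eq)
  qed
  ultimately show ?thesis
    by (simp add: mu_eq num_comps_def hunion)
qed


section \<open>The polymatroid and its base polytope\<close>

text \<open>The total is \<open>mu H (hedges H)\<close> and the other coordinates sum to at most
  \<open>mu H (hedges H - {e})\<close>, so \<open>x e\<close> is at least the increment of
  \<open>mu\<close> at \<open>e\<close>.\<close>

lemma base_polytope_nonneg:
  assumes H: "wf_hypergraph H" and x: "x \<in> base_polytope (hedges H) (mu H)" and e: "e \<in> hedges H"
  shows "0 \<le> x e"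
proof -
  have "insert e (hedges H - {e}) = hedges H"
    using e by auto
  then have "mu H (hedges H - {e}) \<le> mu H (hedges H)"
    using mu_insert_ge[OF H, of e "hedges H - {e}"] by simp
  moreover have "sum x (hedges H - {e}) \<le> mu H (hedges H - {e})" "sum x (hedges H) = mu H (hedges H)"
    using x by (auto simp: base_polytope_def)
  moreover have "sum x (hedges H) = x e + sum x (hedges H - {e})"
    using H e by (intro sum.remove) (simp_all add: wf_hypergraph_def)
  ultimately show ?thesis
    by simp
qed

lemma hypertree_polytope_eq_base_polytope:
  assumes H: "wf_hypergraph H" and conn: "connected_graph (bip H)"
  shows "hypertree_polytope H = base_polytope (hedges H) (mu H)"
proof -
  have "(\<forall>E' \<subseteq> hedges H. sum x E' \<le> mu H E') \<longleftrightarrow>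
    (\<forall>E' \<subseteq> hedges H. E' \<noteq> {} \<longrightarrow>
      sum x E' \<le> real (card (hunion H E')) - real (num_comps H E'))" for x
    by (auto simp: mu_def)
  then show ?thesis
    using base_polytope_nonneg[OF H]
    by (auto simp: hypertree_polytope_def base_polytope_def mu_hedges[OF H conn])
qed

section \<open>Lattice points and forests\<close>

lemma forest_of_lattice_point:
  fixes f :: "'e \<Rightarrow> nat"
  assumes H: "wf_hypergraph H"
    and le: "\<And>E'. E' \<subseteq> hedges H \<Longrightarrow> real (sum f E') \<le> mu H E'"
  shows "\<exists>T. is_subgraph T (bip H) \<and> cycle_free T \<and> (\<forall>e \<in> hedges H. valence T (Inr e) = f e + 1)"
proof -
  have fin: "finite (hverts H)" "finite (hedges H)"
    and ends: "\<And>e. e \<in> hedges H \<Longrightarrow> ends H e \<subseteq> hverts H"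
    using H by (auto simp: wf_hypergraph_def)
  have finite_ends: "finite (ends H e)" if "e \<in> hedges H" for e
    using ends[OF that] fin finite_subset by blast
  \<comment> \<open>A non-empty \<open>E'\<close> has at least one component; subtracting it makes
    the inequality strict.\<close>
  have "sum f E' < card (\<Union>(ends H ` E'))" if "E' \<subseteq> hedges H" "E' \<noteq> {}" for E'
    using le[OF that(1)] num_comps_pos[OF H that] by (simp add: mu_eq hunion_def del: of_nat_sum)
  from strong_hall_trim[OF fin(2) finite_ends this] obtain B where
    B: "\<And>e. e \<in> hedges H \<Longrightarrow> B e \<subseteq> ends H e \<and> card (B e) = f e + 1"
    and hall: "\<And>E'. E' \<subseteq> hedges H \<Longrightarrow> E' \<noteq> {} \<Longrightarrow> sum f E' < card (\<Union>(B ` E'))"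
    by metis
  define T where "T = \<lparr>gverts = gverts (bip H),
    gedges = {{Inl v, Inr e} | v e. e \<in> hedges H \<and> v \<in> B e}\<rparr>"
  have edges: "gedges T = {{Inl v, Inr e} | v e. e \<in> hedges H \<and> v \<in> B e}"
    by (simp add: T_def)
  have "is_subgraph T (bip H)"
    using B ends fin by (fastforce simp: is_subgraph_def wf_graph_def T_def bip_def)
  moreover have "cycle_free T"
    using incidence_cycle_free[OF fin(2) _ hall edges] B by blast
  moreover have "\<forall>e \<in> hedges H. valence T (Inr e) = f e + 1"
    using valence_incidence[OF _ edges] B by simp
  ultimately show ?thesis
    by blast
qed

text \<open>The edges of \<open>T\<close> at \<open>E'\<close> form a forest on the vertices of
  \<open>bip_restrict H E'\<close>. Both its edge count and its vertex count contain the summand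
  \<open>card E'\<close>, which cancels.\<close>

lemma forest_valence_le_mu:
  assumes H: "wf_hypergraph H" and T: "is_subgraph T (bip H)" "cycle_free T"
    and val: "\<And>e. e \<in> hedges H \<Longrightarrow> valence T (Inr e) = f e + 1"
    and E': "E' \<subseteq> hedges H"
  shows "real (sum f E') \<le> mu H E'"
proof -
  let ?W = "gverts (bip_restrict H E')"
  define F where "F = {a \<in> gedges T. \<exists>e \<in> E'. Inr e \<in> a}"
  have finE': "finite E'"
    using E' H finite_subset by (auto simp: wf_hypergraph_def)
  have edge_form: "\<exists>v e. a = {Inl v, Inr e} \<and> v \<in> ends H e" if "a \<in> gedges T" for a
    using T(1) that by (fastforce simp: is_subgraph_def bip_def)
  have finW: "finite ?W"
    by (rule finite_gverts_bip_restrict[OF H E'])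
  have F_sub: "F \<subseteq> gedges (bip_restrict H E')"
  proof
    fix a assume "a \<in> F"
    then obtain e where e: "a \<in> gedges T" "e \<in> E'" "Inr e \<in> a"
      by (auto simp: F_def)
    then show "a \<in> gedges (bip_restrict H E')"
      using edge_form[OF e(1)] by (auto simp: gedges_bip_restrict[OF H E'])
  qed
  have F_edge: "a \<subseteq> ?W \<and> card a = 2" if "a \<in> F" for a
  proof -
    have "a \<in> gedges (bip_restrict H E')"
      using F_sub that by blast
    then obtain v e where "a = {Inl v, Inr e}" "e \<in> E'" "v \<in> ends H e"
      by (auto simp: gedges_bip_restrict[OF H E'])
    then show ?thesis
      by (auto simp: gverts_bip_restrict hunion_def)
  qed
  then have finF: "finite F"
    by (intro finite_subset[of F "Pow ?W"]) (auto simp: finW)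
  have "cycle_free \<lparr>gverts = ?W, gedges = F\<rparr>"
    by (rule cycle_free_mono[OF T(2)]) (auto simp: F_def)
  then have "card F + card (graph_components \<lparr>gverts = ?W, gedges = F\<rparr>) \<le> card ?W"
    using forest_card_edges_plus_components[OF finF finW F_edge] by blast
  moreover have "num_comps H E' \<le> card (graph_components \<lparr>gverts = ?W, gedges = F\<rparr>)"
    unfolding num_comps_def by (rule card_components_antimono) (use finW F_sub in auto)
  \<comment> \<open>Each edge has exactly one hyperedge end, so the edge sets at different members
    of \<open>E'\<close> are disjoint and the valences add up.\<close>
  moreover have "card F = sum f E' + card E'"
  proof -
    have "F = (\<Union>e \<in> E'. {a \<in> gedges T. Inr e \<in> a})"
      by (auto simp: F_def)
    also have "card \<dots> = (\<Sum>e \<in> E'. card {a \<in> gedges T. Inr e \<in> a})"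
    proof (rule card_UN_disjoint[OF finE'])
      show "\<forall>e \<in> E'. finite {a \<in> gedges T. Inr e \<in> a}"
        using finF by (auto simp: F_def elim: rev_finite_subset)
      show "\<forall>d \<in> E'. \<forall>e \<in> E'. d \<noteq> e \<longrightarrow>
          {a \<in> gedges T. Inr d \<in> a} \<inter> {a \<in> gedges T. Inr e \<in> a} = {}"
        using edge_form by fastforce
    qed
    also have "\<dots> = (\<Sum>e \<in> E'. f e + 1)"
      using val E' by (intro sum.cong) (auto simp: valence_def)
    finally show ?thesis
      by (simp only: sum.distrib) simp
  qed
  moreover have "card ?W = card (hunion H E') + card E'"
    unfolding gverts_bip_restrict
    by (subst card_Un_disjoint) (auto simp: finite_hunion[OF H E'] finE' card_image)
  ultimately show ?thesis
    by (simp add: mu_eq del: of_nat_sum)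
qed

theorem proposition4p9:
  fixes H :: "('v, 'e) hypergraph"
  assumes "wf_hypergraph H"
    and "connected_graph (bip H)"
  shows "({x \<in> hypergraph_polymatroid H. \<forall>e \<in> hedges H. x e \<in> \<int>} =
      (\<lambda>f. \<lambda>e \<in> hedges H. real (f e)) `
        {f \<in> hedges H \<rightarrow>\<^sub>E (UNIV :: nat set).
          \<exists>T. is_subgraph T (bip H) \<and> cycle_free T \<and>
              (\<forall>e \<in> hedges H. valence T (Inr e) = f e + 1)}) \<and>
    hypertree_polytope H = base_polytope (hedges H) (mu H)"
    (is "?L = ?emb ` ?R \<and> _")
proof
  have "x \<in> ?emb ` ?R" if x: "x \<in> ?L" for x
  proof -
    have ext: "x \<in> hedges H \<rightarrow>\<^sub>E UNIV" and nonneg: "\<And>e. e \<in> hedges H \<Longrightarrow> 0 \<le> x e"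
      and le: "\<And>E'. E' \<subseteq> hedges H \<Longrightarrow> sum x E' \<le> mu H E'"
      and int: "\<And>e. e \<in> hedges H \<Longrightarrow> x e \<in> \<int>"
      using x by (auto simp: hypergraph_polymatroid_def polymatroid_def)
    \<comment> \<open>The coordinates are non-negative integers, so \<open>nat\<close> and the floor
      lose nothing. The restriction makes \<open>f\<close> \<open>undefined\<close> outside
      \<open>hedges H\<close>, as membership in \<open>?R\<close> demands.\<close>
    define f where "f = (\<lambda>e \<in> hedges H. nat \<lfloor>x e\<rfloor>)"
    have f: "real (f e) = x e" if "e \<in> hedges H" for e
      using nonneg[OF that] int[OF that] that by (auto simp: f_def elim: Ints_cases)
    have "real (sum f E') \<le> mu H E'" if "E' \<subseteq> hedges H" for E'
    proof -
      have "real (sum f E') = sum x E'"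
        unfolding of_nat_sum using f that by (intro sum.cong) auto
      then show ?thesis
        using le[OF that] by simp
    qed
    from forest_of_lattice_point[OF assms(1) this] have "f \<in> ?R"
      by (simp add: f_def)
    moreover have "x = ?emb f"
      using ext f by (auto simp: fun_eq_iff PiE_def extensional_def)
    ultimately show ?thesis
      by blast
  qed
  moreover have "?emb f \<in> ?L" if f: "f \<in> ?R" for f
  proof -
    have "sum (?emb f) E' \<le> mu H E'" if E': "E' \<subseteq> hedges H" for E'
    proof -
      have "sum (?emb f) E' = real (sum f E')"
        unfolding of_nat_sum using E' by (intro sum.cong) auto
      then show ?thesis
        using f forest_valence_le_mu[OF assms(1) _ _ _ E', of _ f] by auto
    qed
    then show ?thesis
      by (auto simp: hypergraph_polymatroid_def polymatroid_def)
  qed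
  ultimately show "?L = ?emb ` ?R"
    by blast
  show "hypertree_polytope H = base_polytope (hedges H) (mu H)"
    by (rule hypertree_polytope_eq_base_polytope[OF assms])
qed

end
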